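(* Let $\lambda_1,\lambda_2,\lambda_3$ be real numbers with $0<\lambda_i<\frac12$ for $i=1,2,3$. Then the polynomial automorphism $\gamma$ of $\mathbb{C}^3$ given by $$\gamma:(x,y,z)\mapsto\left(\lambda_1(y+xz),\ \lambda_2x,\ \lambda_3z\right)$$ is a contraction and has linear degree growth, i.e. $\deg\gamma^n$ grows linearly in $n$.
   Context: A polynomial automorphism of $\mathbb{C}^d$ is a bijective polynomial map $\mathbb{C}^d\to\mathbb{C}^d$ whose inverse is also polynomial. If $\gamma$ is given by $(x_1,\dots,x_d)\mapsto (P_1(x_1,\dots,x_d),\dots,P_d(x_1,\dots,x_d))$, its degree $\deg\gamma$ is the largest among the (total) degrees of the polynomials $P_i$. $\gamma^n$ denotes the $n$-th iterate of $\gamma$ under composition. An automorphism $\gamma$ of $\mathbb{C}^d$ is called a contraction if $0$ is its unique fixed point and $\lim_{n\to\infty}\gamma^n(x)=0$ for all $x\in\mathbb{C}^d$. Linear degree growth means that there are constants $0<c\le C$ with $cn\le\deg\gamma^n\le Cn$ for all $n\ge1$. *)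

theory Defs
  imports "HOL-Analysis.Analysis" "HOL-Library.Poly_Mapping"
begin

text \<open>
  Polynomials in the variables indexed by the finite type \<open>'n\<close> are finitely supported maps
  from exponent vectors to coefficients, i.e. the ring \<open>('n \<Rightarrow>\<^sub>0 nat) \<Rightarrow>\<^sub>0 complex\<close>.
\<close>

type_synonym 'n cpoly = "('n \<Rightarrow>\<^sub>0 nat) \<Rightarrow>\<^sub>0 complex"

definition cpoly_eval :: "'n::finite cpoly \<Rightarrow> complex ^ 'n \<Rightarrow> complex" where
  "cpoly_eval p x =
     (\<Sum>m\<in>Poly_Mapping.keys p.
        Poly_Mapping.lookup p m * (\<Prod>i\<in>UNIV. (x $ i) ^ Poly_Mapping.lookup m i))"

text \<open>The zero polynomial gets degree \<open>0\<close>.\<close>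

definition cpoly_degree :: "'n::finite cpoly \<Rightarrow> nat" where
  "cpoly_degree p =
     Max (insert 0 ((\<lambda>m. \<Sum>i\<in>UNIV. Poly_Mapping.lookup m i) ` Poly_Mapping.keys p))"

definition represents :: "('n::finite \<Rightarrow> 'n cpoly) \<Rightarrow> (complex ^ 'n \<Rightarrow> complex ^ 'n) \<Rightarrow> bool" where
  "represents P f \<longleftrightarrow> (\<forall>x i. f x $ i = cpoly_eval (P i) x)"

definition polynomial_map :: "(complex ^ 'n::finite \<Rightarrow> complex ^ 'n) \<Rightarrow> bool" where
  "polynomial_map f \<longleftrightarrow> (\<exists>P. represents P f)"

text \<open>
  A polynomial map has exactly one tuple of component polynomials (lemma
  \<open>represents_unique\<close> below); on other maps \<open>map_degree\<close> is unspecified.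
\<close>

definition map_degree :: "(complex ^ 'n::finite \<Rightarrow> complex ^ 'n) \<Rightarrow> nat" where
  "map_degree f = Max (range (\<lambda>i. cpoly_degree ((THE P. represents P f) i)))"

definition poly_automorphism :: "(complex ^ 'n::finite \<Rightarrow> complex ^ 'n) \<Rightarrow> bool" where
  "poly_automorphism f \<longleftrightarrow> bij f \<and> polynomial_map f \<and> polynomial_map (inv f)"

definition contraction :: "(complex ^ 'n::finite \<Rightarrow> complex ^ 'n) \<Rightarrow> bool" where
  "contraction f \<longleftrightarrow>
     poly_automorphism f \<and> {x. f x = x} = {0} \<and> (\<forall>x. (\<lambda>n. (f ^^ n) x) \<longlonglongrightarrow> 0)"

definition linear_degree_growth :: "(complex ^ 'n::finite \<Rightarrow> complex ^ 'n) \<Rightarrow> bool" where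
  "linear_degree_growth f \<longleftrightarrow>
     (\<exists>c C :: real. 0 < c \<and> c \<le> C \<and>
        (\<forall>n\<ge>1. c * real n \<le> real (map_degree (f ^^ n)) \<and>
               real (map_degree (f ^^ n)) \<le> C * real n))"

definition gamma :: "real \<Rightarrow> real \<Rightarrow> real \<Rightarrow> complex ^ 3 \<Rightarrow> complex ^ 3" where
  "gamma l1 l2 l3 v =
     vector [of_real l1 * (v $ 2 + v $ 1 * v $ 3), of_real l2 * v $ 1, of_real l3 * v $ 3]"

lemma monomials_independent:
  fixes c :: "'m \<Rightarrow> complex" and e :: "'m \<Rightarrow> 'n \<Rightarrow> nat"
  assumes "finite I" "finite S"
    and "\<And>m m'. m \<in> S \<Longrightarrow> m' \<in> S \<Longrightarrow> (\<forall>i\<in>I. e m i = e m' i) \<Longrightarrow> m = m'"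
    and "\<And>x :: 'n \<Rightarrow> complex. (\<Sum>m\<in>S. c m * (\<Prod>i\<in>I. x i ^ e m i)) = 0"
    and "m \<in> S"
  shows "c m = 0"
  using assms
proof (induction I arbitrary: S m rule: finite_induct)
  case empty
  then have "S = {m}" by auto
  with empty show ?case by simp
next
  case (insert j I)
  define N where "N = Max ((\<lambda>m. e m j) ` S)"
  define a where "a k x = (\<Sum>m\<in>{m\<in>S. e m j = k}. c m * (\<Prod>i\<in>I. x i ^ e m i))"
    for k and x :: "'n \<Rightarrow> complex"
  have N: "e m j \<le> N" if "m \<in> S" for m
    using that insert.prems(1) unfolding N_def by (intro Max_ge) auto
  have "a k x = 0" if "k \<le> N" for k x
  proof -
    have "(\<Sum>k\<le>N. a k x * t ^ k) = 0" for t
    proof -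
      let ?x = "x(j := t)"
      have pr: "(\<Prod>i\<in>insert j I. ?x i ^ e m i) = t ^ e m j * (\<Prod>i\<in>I. x i ^ e m i)" for m
      proof -
        have "(\<Prod>i\<in>I. ?x i ^ e m i) = (\<Prod>i\<in>I. x i ^ e m i)"
          using insert.hyps(2) by (intro prod.cong) auto
        then show ?thesis using insert.hyps by simp
      qed
      have "0 = (\<Sum>m\<in>S. c m * (t ^ e m j * (\<Prod>i\<in>I. x i ^ e m i)))"
        using insert.prems(3)[of ?x] unfolding pr by simp
      also have "\<dots> = (\<Sum>k\<le>N. \<Sum>m\<in>{m\<in>S. e m j = k}. c m * (t ^ e m j * (\<Prod>i\<in>I. x i ^ e m i)))"
        using insert.prems(1) N by (intro sum.group[symmetric]) auto
      also have "\<dots> = (\<Sum>k\<le>N. a k x * t ^ k)"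
        unfolding a_def sum_distrib_right by (intro sum.cong) (auto simp: mult_ac)
      finally show ?thesis by simp
    qed
    then show ?thesis using that polyfun_eq_0[of "\<lambda>k. a k x" N] by blast
  qed
  then have "a (e m j) x = 0" for x using N[OF insert.prems(4)] by blast
  then show ?case
    using insert.prems unfolding a_def
    by (intro insert.IH[of "{m'\<in>S. e m' j = e m j}"]) auto
qed

lemma cpoly_eval_inject:
  fixes p q :: "'n::finite cpoly"
  assumes "\<And>x. cpoly_eval p x = cpoly_eval q x"
  shows "p = q"
proof (rule poly_mapping_eqI)
  fix m
  let ?S = "Poly_Mapping.keys p \<union> Poly_Mapping.keys q"
  let ?M = "\<lambda>m x. \<Prod>i\<in>UNIV. (x i :: complex) ^ Poly_Mapping.lookup m i"
  have ev: "cpoly_eval r (\<chi> i. x i) = (\<Sum>m\<in>?S. Poly_Mapping.lookup r m * ?M m x)"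
    if "r = p \<or> r = q" for r :: "'n cpoly" and x
    unfolding cpoly_eval_def using that
    by (intro sum.mono_neutral_cong_left) (auto simp: in_keys_iff)
  have "(\<Sum>m\<in>?S. (Poly_Mapping.lookup p m - Poly_Mapping.lookup q m) * ?M m x) = 0" for x
    using assms[of "\<chi> i. x i"] ev[of p x] ev[of q x]
    by (simp add: left_diff_distrib sum_subtractf)
  then have "Poly_Mapping.lookup p m - Poly_Mapping.lookup q m = 0" if "m \<in> ?S"
    using that
    by (intro monomials_independent[where I = UNIV and S = ?S and e = Poly_Mapping.lookup
          and c = "\<lambda>m. Poly_Mapping.lookup p m - Poly_Mapping.lookup q m"])
       (auto intro: poly_mapping_eqI)
  then show "Poly_Mapping.lookup p m = Poly_Mapping.lookup q m"
    by (cases "m \<in> ?S") (auto simp: in_keys_iff)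
qed

lemma represents_unique:
  assumes "represents P f" "represents Q f"
  shows "P = Q"
  using assms unfolding represents_def by (metis cpoly_eval_inject ext)

lemma map_degree_eq:
  assumes "represents P f"
  shows "map_degree f = Max (range (\<lambda>i. cpoly_degree (P i)))"
proof -
  have "(THE P. represents P f) = P"
    using assms represents_unique by blast
  then show ?thesis by (simp add: map_degree_def)
qed

end

theory Submission
  imports Defs
begin

text \<open>
  Write \<open>(x\<^sub>n, y\<^sub>n, z\<^sub>n)\<close> for the \<open>n\<close>-th iterate of \<open>(x, y, z)\<close>. The third coordinate evolves
  on its own, \<open>z\<^sub>n = l3\<^sup>n z\<close>, so the map is a skew product over a linear contraction of the \<open>z\<close>-axis
  whose fibre maps \<open>(x, y) \<mapsto> (l1 (y + z x), l2 x)\<close> are linear.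

  Convergence. Once \<open>z\<^sub>n\<close> has norm at most \<open>1/2\<close>, the fibre map shrinks the norm \<open>|x| + |y|\<close>
  by the factor \<open>3/4\<close>: the new first coordinate is at most \<open>|y|/2 + |x|/4\<close> and the new second one
  at most \<open>|x|/2\<close>. Hence every orbit tends to \<open>0\<close> (lemma \<open>gamma_orbit_tendsto_0\<close>), and
  a fixed point, having a constant orbit, must be \<open>0\<close>.

  Degree. Each step multiplies \<open>x\<close> by the coordinate \<open>z\<^sub>n\<close>, which has degree one however large
  \<open>n\<close> is. So a step raises the degree by at most one and \<open>\<gamma>\<^sup>n\<close> has degree at most \<open>n + 1\<close>. No
  cancellation occurs because all coefficients are positive: on the diagonal \<open>x = y = z = t > 0\<close>
  the first coordinate is at least \<open>K t\<^sup>n\<^sup>+\<^sup>1\<close> with \<open>K > 0\<close>, which no polynomial of degree at most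
  \<open>n\<close> achieves as \<open>t\<close> grows. Thus the degree is exactly \<open>n + 1\<close>
  (lemma \<open>map_degree_gamma_iterate\<close>).
\<close>

section \<open>Polynomial functions of bounded degree\<close>

text \<open>
  Degree bounds are handled on the level of functions: closure under sums and products can then
  be shown by expanding into monomials.
\<close>

definition poly_fun_le :: "nat \<Rightarrow> (complex ^ 'n::finite \<Rightarrow> complex) \<Rightarrow> bool" where
  "poly_fun_le d f \<longleftrightarrow> (\<exists>p. cpoly_degree p \<le> d \<and> f = cpoly_eval p)"

lemma cpoly_degree_le_iff:
  "cpoly_degree p \<le> d \<longleftrightarrow>
    (\<forall>m\<in>Poly_Mapping.keys p. (\<Sum>i\<in>UNIV. Poly_Mapping.lookup m i) \<le> d)"
  unfolding cpoly_degree_def by (subst Max_le_iff) auto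

lemma cpoly_eval_superset:
  assumes "finite S" "Poly_Mapping.keys p \<subseteq> S"
  shows "cpoly_eval p x =
    (\<Sum>m\<in>S. Poly_Mapping.lookup p m * (\<Prod>i\<in>UNIV. (x $ i) ^ Poly_Mapping.lookup m i))"
  unfolding cpoly_eval_def
  using assms by (intro sum.mono_neutral_left) (auto simp: in_keys_iff)

lemma cpoly_eval_add: "cpoly_eval (p + q) x = cpoly_eval p x + cpoly_eval q x"
proof -
  let ?S = "Poly_Mapping.keys p \<union> Poly_Mapping.keys q"
  have "Poly_Mapping.keys (p + q) \<subseteq> ?S"
    by (rule Poly_Mapping.keys_add)
  then show ?thesis
    by (simp add: cpoly_eval_superset[of ?S] lookup_add distrib_right sum.distrib)
qed

lemma cpoly_eval_single:
  "cpoly_eval (Poly_Mapping.single m c) x = c * (\<Prod>i\<in>UNIV. (x $ i) ^ Poly_Mapping.lookup m i)"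
  by (simp add: cpoly_eval_superset[of "{m}"])

lemma poly_fun_le_mono: "poly_fun_le d f \<Longrightarrow> d \<le> e \<Longrightarrow> poly_fun_le e f"
  unfolding poly_fun_le_def by (blast intro: order_trans)

lemma poly_fun_le_monomial:
  assumes "(\<Sum>i\<in>UNIV. Poly_Mapping.lookup m i) \<le> d"
  shows "poly_fun_le d (\<lambda>x. c * (\<Prod>i\<in>UNIV. (x $ i) ^ Poly_Mapping.lookup m i))"
  unfolding poly_fun_le_def
  using assms
  by (intro exI[of _ "Poly_Mapping.single m c"])
     (auto simp: cpoly_degree_le_iff cpoly_eval_single fun_eq_iff)

lemma poly_fun_le_const: "poly_fun_le d (\<lambda>x. c)"
  using poly_fun_le_monomial[of 0 d c] by simp

lemma poly_fun_le_coord: "poly_fun_le 1 (\<lambda>x. x $ i)"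
proof -
  have "(\<Prod>j\<in>UNIV. (x $ j) ^ (1 when i = j)) = x $ i" for x :: "complex ^ 'a"
    using prod.delta[of UNIV i "\<lambda>j. x $ j"]
    by (simp add: when_def if_distrib[of "power _"] eq_commute[of i] cong: if_cong)
  moreover have "(\<Sum>j\<in>UNIV. (1::nat) when i = j) = 1"
    by (simp add: when_def)
  ultimately show ?thesis
    using poly_fun_le_monomial[of "Poly_Mapping.single i 1" 1 1]
    by (simp add: lookup_single)
qed

lemma poly_fun_le_add:
  assumes "poly_fun_le d f" "poly_fun_le d g"
  shows "poly_fun_le d (\<lambda>x. f x + g x)"
proof -
  from assms obtain p q where "cpoly_degree p \<le> d" "f = cpoly_eval p"
    "cpoly_degree q \<le> d" "g = cpoly_eval q"
    unfolding poly_fun_le_def by blast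
  moreover have "cpoly_degree (p + q) \<le> d" if "cpoly_degree p \<le> d" "cpoly_degree q \<le> d"
    using that Poly_Mapping.keys_add[of p q] unfolding cpoly_degree_le_iff by blast
  ultimately show ?thesis
    unfolding poly_fun_le_def by (intro exI[of _ "p + q"]) (auto simp: cpoly_eval_add)
qed

lemma poly_fun_le_sum:
  assumes "\<And>a. a \<in> A \<Longrightarrow> poly_fun_le d (f a)"
  shows "poly_fun_le d (\<lambda>x. \<Sum>a\<in>A. f a x)"
  using assms
  by (induction A rule: infinite_finite_induct) (auto intro: poly_fun_le_const poly_fun_le_add)

lemma poly_fun_le_mult:
  assumes "poly_fun_le d f" "poly_fun_le e g"
  shows "poly_fun_le (d + e) (\<lambda>x. f x * g x)"
proof -
  from assms obtain p q where p: "cpoly_degree p \<le> d" "f = cpoly_eval p"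
    and q: "cpoly_degree q \<le> e" "g = cpoly_eval q"
    unfolding poly_fun_le_def by blast
  have "f x * g x = (\<Sum>m\<in>Poly_Mapping.keys p. \<Sum>m'\<in>Poly_Mapping.keys q.
      (Poly_Mapping.lookup p m * Poly_Mapping.lookup q m') *
      (\<Prod>i\<in>UNIV. (x $ i) ^ Poly_Mapping.lookup (m + m') i))" for x
    unfolding p q cpoly_eval_def
    by (simp add: sum_product lookup_add power_add prod.distrib mult_ac)
  moreover have "(\<Sum>i\<in>UNIV. Poly_Mapping.lookup (m + m') i) \<le> d + e"
    if "m \<in> Poly_Mapping.keys p" "m' \<in> Poly_Mapping.keys q" for m m'
    using p(1) q(1) that unfolding cpoly_degree_le_iff
    by (simp add: lookup_add sum.distrib add_mono)
  ultimately show ?thesis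
    by (auto intro!: poly_fun_le_sum poly_fun_le_monomial)
qed

lemma poly_fun_le_cmult: "poly_fun_le d f \<Longrightarrow> poly_fun_le d (\<lambda>x. c * f x)"
  using poly_fun_le_mult[OF poly_fun_le_const[of 0 c]] by simp

lemma represents_of_poly_fun_le:
  assumes "\<And>i. poly_fun_le d (\<lambda>x. f x $ i)"
  obtains P where "represents P f" "\<And>i. cpoly_degree (P i) \<le> d"
proof -
  from assms have "\<forall>i. \<exists>p. cpoly_degree p \<le> d \<and> (\<lambda>x. f x $ i) = cpoly_eval p"
    unfolding poly_fun_le_def by blast
  then obtain P where "\<And>i. cpoly_degree (P i) \<le> d \<and> (\<lambda>x. f x $ i) = cpoly_eval (P i)"
    by metis
  then show ?thesis
    by (intro that[of P]) (auto simp: represents_def fun_eq_iff)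
qed

lemma polynomial_map_of_poly_fun_le:
  "(\<And>i. poly_fun_le d (\<lambda>x. f x $ i)) \<Longrightarrow> polynomial_map f"
  unfolding polynomial_map_def by (metis represents_of_poly_fun_le)

lemma map_degree_le:
  assumes "\<And>i. poly_fun_le d (\<lambda>x. f x $ i)"
  shows "map_degree f \<le> d"
proof -
  from assms obtain P where P: "represents P f" "\<And>i. cpoly_degree (P i) \<le> d"
    by (rule represents_of_poly_fun_le) auto
  then show ?thesis
    by (simp add: map_degree_eq[OF P(1)])
qed

section \<open>Growth on the diagonal bounds the degree from below\<close>

lemma cpoly_eval_diagonal_growth:
  assumes "cpoly_degree p \<le> d" "(1::real) \<le> t"
  shows "norm (cpoly_eval p (\<chi> i. of_real t)) \<le>
    (\<Sum>m\<in>Poly_Mapping.keys p. norm (Poly_Mapping.lookup p m)) * t ^ d"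
proof -
  have "norm (cpoly_eval p (\<chi> i. of_real t)) \<le>
      (\<Sum>m\<in>Poly_Mapping.keys p. norm (Poly_Mapping.lookup p m) *
        t ^ (\<Sum>i\<in>UNIV. Poly_Mapping.lookup m i))"
    unfolding cpoly_eval_def
    by (rule order_trans[OF norm_sum])
       (use assms(2) in \<open>simp add: norm_mult norm_power power_sum flip: prod_norm\<close>)
  also have "\<dots> \<le> (\<Sum>m\<in>Poly_Mapping.keys p. norm (Poly_Mapping.lookup p m) * t ^ d)"
    using assms by (intro sum_mono mult_left_mono power_increasing) (auto simp: cpoly_degree_le_iff)
  finally show ?thesis
    by (simp add: sum_distrib_right)
qed

lemma map_degree_ge_of_diagonal_growth:
  fixes f :: "complex ^ 'n::finite \<Rightarrow> complex ^ 'n"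
  assumes "polynomial_map f" "0 < K"
    and growth: "\<And>t::real. 1 \<le> t \<Longrightarrow> K * t ^ k \<le> norm (f (\<chi> i. of_real t) $ j)"
  shows "k \<le> map_degree f"
proof (rule ccontr)
  assume "\<not> k \<le> map_degree f"
  then have less: "Suc (map_degree f) \<le> k" by simp
  from assms(1) obtain P where P: "represents P f"
    unfolding polynomial_map_def by blast
  have deg: "cpoly_degree (P j) \<le> map_degree f"
    unfolding map_degree_eq[OF P] by (intro Max_ge) auto
  define C where
    "C = (\<Sum>m\<in>Poly_Mapping.keys (P j). norm (Poly_Mapping.lookup (P j) m))"
  have "C \<ge> 0" unfolding C_def by (intro sum_nonneg) auto
  \<comment> \<open>At this point \<open>K t\<close> exceeds \<open>C\<close>, so one surplus power of \<open>t\<close> is already contradictory.\<close>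
  define t where "t = C / K + 1"
  have t: "1 \<le> t" "C < K * t"
    using \<open>C \<ge> 0\<close> \<open>0 < K\<close> by (auto simp: t_def field_simps)
  have "K * t * t ^ map_degree f = K * t ^ Suc (map_degree f)" by simp
  also have "\<dots> \<le> K * t ^ k"
    using less t \<open>0 < K\<close> by (intro mult_left_mono power_increasing) auto
  also have "\<dots> \<le> norm (f (\<chi> i. of_real t) $ j)"
    using growth t by blast
  also have "\<dots> = norm (cpoly_eval (P j) (\<chi> i. of_real t))"
    using P by (simp add: represents_def)
  also have "\<dots> \<le> C * t ^ map_degree f"
    unfolding C_def by (rule cpoly_eval_diagonal_growth[OF deg t(1)])
  finally show False
    using t by (simp add: mult_le_cancel_right)
qed

section \<open>The map and its inverse\<close>

lemma gamma_nth:
  "gamma l1 l2 l3 v $ 1 = of_real l1 * (v $ 2 + v $ 1 * v $ 3)"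
  "gamma l1 l2 l3 v $ 2 = of_real l2 * v $ 1"
  "gamma l1 l2 l3 v $ 3 = of_real l3 * v $ 3"
  by (simp_all add: gamma_def)

definition gamma_inv :: "real \<Rightarrow> real \<Rightarrow> real \<Rightarrow> complex ^ 3 \<Rightarrow> complex ^ 3" where
  "gamma_inv l1 l2 l3 v =
     vector [of_real (1 / l2) * v $ 2,
       of_real (1 / l1) * v $ 1 + of_real (- 1 / (l2 * l3)) * (v $ 2 * v $ 3),
       of_real (1 / l3) * v $ 3]"

lemma gamma_inv_nth:
  "gamma_inv l1 l2 l3 v $ 1 = of_real (1 / l2) * v $ 2"
  "gamma_inv l1 l2 l3 v $ 2 =
    of_real (1 / l1) * v $ 1 + of_real (- 1 / (l2 * l3)) * (v $ 2 * v $ 3)"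
  "gamma_inv l1 l2 l3 v $ 3 = of_real (1 / l3) * v $ 3"
  by (simp_all add: gamma_inv_def)

lemma gamma_inv_gamma:
  assumes "l1 \<noteq> 0" "l2 \<noteq> 0" "l3 \<noteq> 0"
  shows "gamma_inv l1 l2 l3 (gamma l1 l2 l3 v) = v"
  using assms by (simp add: gamma_nth gamma_inv_nth vec_eq_iff forall_3 field_simps)

lemma gamma_gamma_inv:
  assumes "l1 \<noteq> 0" "l2 \<noteq> 0" "l3 \<noteq> 0"
  shows "gamma l1 l2 l3 (gamma_inv l1 l2 l3 v) = v"
  using assms by (simp add: gamma_nth gamma_inv_nth vec_eq_iff forall_3 field_simps)

text \<open>
  The degree grows by one per step only because the third coordinate stays of degree one; this
  is why it must be part of the induction.
\<close>

lemma gamma_iterate_poly_fun_le: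
  "poly_fun_le (Suc n) (\<lambda>v. (gamma l1 l2 l3 ^^ n) v $ 1) \<and>
   poly_fun_le (Suc n) (\<lambda>v. (gamma l1 l2 l3 ^^ n) v $ 2) \<and>
   poly_fun_le 1 (\<lambda>v. (gamma l1 l2 l3 ^^ n) v $ 3)"
proof (induction n)
  case 0
  then show ?case using poly_fun_le_coord by auto
next
  case (Suc n)
  let ?c = "\<lambda>i v. (gamma l1 l2 l3 ^^ n) v $ i"
  have "poly_fun_le (Suc n + 1) (\<lambda>v. of_real l1 * (?c 2 v + ?c 1 v * ?c 3 v))"
    using Suc by (intro poly_fun_le_cmult poly_fun_le_add poly_fun_le_mult)
                 (auto intro: poly_fun_le_mono)
  moreover have "poly_fun_le (Suc (Suc n)) (\<lambda>v. of_real l2 * ?c 1 v)"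
    using Suc by (intro poly_fun_le_cmult) (auto intro: poly_fun_le_mono)
  moreover have "poly_fun_le 1 (\<lambda>v. of_real l3 * ?c 3 v)"
    using Suc by (intro poly_fun_le_cmult) auto
  ultimately show ?case by (simp add: gamma_nth)
qed

lemma gamma_iterate_component_poly_fun_le:
  "poly_fun_le (Suc n) (\<lambda>v. (gamma l1 l2 l3 ^^ n) v $ i)"
  using gamma_iterate_poly_fun_le[of n l1 l2 l3] exhaust_3[of i]
  by (auto intro: poly_fun_le_mono)

lemma polynomial_map_gamma_iterate: "polynomial_map (gamma l1 l2 l3 ^^ n)"
  by (rule polynomial_map_of_poly_fun_le[OF gamma_iterate_component_poly_fun_le])

lemma polynomial_map_gamma_inv: "polynomial_map (gamma_inv l1 l2 l3)"
proof (rule polynomial_map_of_poly_fun_le)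
  have c: "poly_fun_le 2 (\<lambda>v. v $ i)" for i :: 3
    using poly_fun_le_coord by (rule poly_fun_le_mono) simp
  have "poly_fun_le 2 (\<lambda>v. v $ i * v $ j)" for i j :: 3
    using poly_fun_le_mult[OF poly_fun_le_coord poly_fun_le_coord, of i j]
    by (simp add: numeral_2_eq_2)
  then show "poly_fun_le 2 (\<lambda>v. gamma_inv l1 l2 l3 v $ i)" for i
    using c exhaust_3[of i]
    by (elim disjE) (simp only: gamma_inv_nth, intro poly_fun_le_add poly_fun_le_cmult, simp_all)+
qed

lemma poly_automorphism_gamma:
  assumes "l1 \<noteq> 0" "l2 \<noteq> 0" "l3 \<noteq> 0"
  shows "poly_automorphism (gamma l1 l2 l3)"
proof -
  note inverse = gamma_inv_gamma[OF assms] gamma_gamma_inv[OF assms]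
  have "bij (gamma l1 l2 l3)"
    by (rule o_bij[of "gamma_inv l1 l2 l3"]) (auto simp: inverse)
  moreover have "inv (gamma l1 l2 l3) = gamma_inv l1 l2 l3"
    by (rule inv_equality) (auto simp: inverse)
  ultimately show ?thesis
    using polynomial_map_gamma_inv polynomial_map_gamma_iterate[of 1 l1 l2 l3]
    by (simp add: poly_automorphism_def)
qed

section \<open>Convergence of orbits\<close>

lemma gamma_iterate_nth_3: "(gamma l1 l2 l3 ^^ n) v $ 3 = of_real l3 ^ n * v $ 3"
  by (induction n) (auto simp: gamma_nth)

lemma eventually_contracting_tendsto_0:
  fixes s :: "nat \<Rightarrow> real"
  assumes "\<And>n. 0 \<le> s n" "0 \<le> q" "q < 1"
    and step: "\<And>n. N \<le> n \<Longrightarrow> s (Suc n) \<le> q * s n"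
  shows "s \<longlonglongrightarrow> 0"
proof -
  have le: "s (n + N) \<le> q ^ n * s N" for n
  proof (induction n)
    case (Suc n)
    have "s (Suc n + N) \<le> q * s (n + N)" using step[of "n + N"] by simp
    also have "\<dots> \<le> q * (q ^ n * s N)" using Suc assms(2) by (rule mult_left_mono)
    finally show ?case by (simp add: mult_ac)
  qed simp
  have "(\<lambda>n. q ^ n * s N) \<longlonglongrightarrow> 0"
    using assms(2,3) by (intro tendsto_mult_left_zero LIMSEQ_power_zero) auto
  then have "(\<lambda>n. s (n + N)) \<longlonglongrightarrow> 0"
    by (rule tendsto_sandwich[OF _ _ tendsto_const, rotated 2]) (use assms(1) le in auto)
  then show ?thesis by (rule LIMSEQ_offset)
qed

lemma gamma_fibre_contraction:
  assumes l: "0 < l1" "l1 < 1 / 2" "0 < l2" "l2 < 1 / 2"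
    and z: "norm (v $ 3) \<le> 1 / 2"
  shows "norm (gamma l1 l2 l3 v $ 1) + norm (gamma l1 l2 l3 v $ 2)
    \<le> 3 / 4 * (norm (v $ 1) + norm (v $ 2))"
proof -
  have "norm (v $ 2 + v $ 1 * v $ 3) \<le> norm (v $ 2) + norm (v $ 1) * (1 / 2)"
    using z mult_left_mono[OF z norm_ge_zero[of "v $ 1"]]
    by (intro norm_triangle_le) (simp add: norm_mult)
  then have "norm (gamma l1 l2 l3 v $ 1) \<le> 1 / 2 * (norm (v $ 2) + norm (v $ 1) * (1 / 2))"
    using l unfolding gamma_nth norm_mult by (intro mult_mono) auto
  moreover have "norm (gamma l1 l2 l3 v $ 2) \<le> 1 / 2 * norm (v $ 1)"
    using l unfolding gamma_nth norm_mult by (intro mult_right_mono) auto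
  moreover have "0 \<le> norm (v $ 2)" by (rule norm_ge_zero)
  moreover have "p + q \<le> 3 / 4 * (a + b)"
    if "p \<le> 1 / 2 * (b + a * (1 / 2))" "q \<le> 1 / 2 * a" "0 \<le> b" for a b p q :: real
    using that by simp
  ultimately show ?thesis by blast
qed

lemma gamma_orbit_tendsto_0:
  assumes l: "0 < l1" "l1 < 1 / 2" "0 < l2" "l2 < 1 / 2" "0 < l3" "l3 < 1"
  shows "(\<lambda>n. (gamma l1 l2 l3 ^^ n) v) \<longlonglongrightarrow> 0"
proof -
  let ?c = "\<lambda>i n. (gamma l1 l2 l3 ^^ n) v $ i"
  define s where "s n = norm (?c 1 n) + norm (?c 2 n)" for n
  have z: "?c 3 \<longlonglongrightarrow> 0"
    unfolding gamma_iterate_nth_3 using l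
    by (intro tendsto_mult_left_zero LIMSEQ_power_zero) auto
  then obtain N where N: "norm (?c 3 n) \<le> 1 / 2" if "N \<le> n" for n
    using LIMSEQ_D[OF z, of "1 / 2"] by (force intro: less_imp_le)
  have "s \<longlonglongrightarrow> 0"
  proof (rule eventually_contracting_tendsto_0)
    show "s (Suc n) \<le> 3 / 4 * s n" if "N \<le> n" for n
      using gamma_fibre_contraction[OF l(1-4) N[OF that]] by (simp add: s_def)
  qed (auto simp: s_def)
  then have "?c 1 \<longlonglongrightarrow> 0" "?c 2 \<longlonglongrightarrow> 0"
    by (rule Lim_null_comparison[rotated]; simp add: s_def)+
  with z have "?c i \<longlonglongrightarrow> 0" for i
    using exhaust_3[of i] by auto
  then show ?thesis
    by (intro vec_tendstoI) simp
qed

text \<open>Uniqueness of the fixed point comes for free: the orbit of a fixed point is constant.\<close>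

lemma contraction_of_orbits_tendsto_0:
  assumes "poly_automorphism f" "f 0 = 0" and lim: "\<And>x. (\<lambda>n. (f ^^ n) x) \<longlonglongrightarrow> 0"
  shows "contraction f"
proof -
  have "x = 0" if "f x = x" for x
  proof -
    have "(f ^^ n) x = x" for n using that by (induction n) auto
    then show ?thesis using lim[of x] by (simp add: LIMSEQ_const_iff)
  qed
  with assms show ?thesis unfolding contraction_def by auto
qed

section \<open>Degree of the iterates\<close>

text \<open>
  On the positive diagonal all coordinates stay nonnegative, so the summand \<open>y\<close> can only help
  and the lower bound for the first coordinate gains the factor \<open>l1 l3\<^sup>n t\<close> at step \<open>n\<close>.
\<close>

lemma gamma_iterate_diagonal_growth:
  assumes l: "0 < l1" "0 < l2" "0 < l3"
  shows "\<exists>K>0. \<forall>t\<ge>0. \<exists>a b. (gamma l1 l2 l3 ^^ n) (\<chi> i. of_real t) $ 1 = of_real a \<and>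
    (gamma l1 l2 l3 ^^ n) (\<chi> i. of_real t) $ 2 = of_real b \<and> K * t ^ Suc n \<le> a \<and> 0 \<le> b"
proof (induction n)
  case 0
  show ?case by (rule exI[of _ 1]) auto
next
  case (Suc n)
  then obtain K where K: "K > 0" and IH: "\<And>t. t \<ge> 0 \<Longrightarrow>
      \<exists>a b. (gamma l1 l2 l3 ^^ n) (\<chi> i. of_real t) $ 1 = of_real a \<and>
        (gamma l1 l2 l3 ^^ n) (\<chi> i. of_real t) $ 2 = of_real b \<and> K * t ^ Suc n \<le> a \<and> 0 \<le> b"
    by blast
  show ?case
  proof (rule exI[of _ "l1 * l3 ^ n * K"], intro conjI allI impI)
    show "0 < l1 * l3 ^ n * K" using l K by simp
    fix t :: real assume t: "0 \<le> t"
    obtain a b where ab: "(gamma l1 l2 l3 ^^ n) (\<chi> i. of_real t) $ 1 = of_real a"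
      "(gamma l1 l2 l3 ^^ n) (\<chi> i. of_real t) $ 2 = of_real b" "K * t ^ Suc n \<le> a" "0 \<le> b"
      using IH[OF t] by blast
    have "0 \<le> K * t ^ Suc n" using K t by simp
    then have "0 \<le> a" using ab(3) by linarith
    have "K * t ^ Suc n * (l3 ^ n * t) \<le> a * (l3 ^ n * t)"
      using ab(3) l t by (intro mult_right_mono) auto
    also have "\<dots> \<le> b + a * (l3 ^ n * t)" using ab(4) by simp
    finally have "l1 * (K * t ^ Suc n * (l3 ^ n * t)) \<le> l1 * (b + a * (l3 ^ n * t))"
      using l(1) by (intro mult_left_mono) auto
    then have "l1 * l3 ^ n * K * t ^ Suc (Suc n) \<le> l1 * (b + a * (l3 ^ n * t))"
      by (simp add: mult_ac)
    then show "\<exists>a b. (gamma l1 l2 l3 ^^ Suc n) (\<chi> i. of_real t) $ 1 = of_real a \<and>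
        (gamma l1 l2 l3 ^^ Suc n) (\<chi> i. of_real t) $ 2 = of_real b \<and>
        l1 * l3 ^ n * K * t ^ Suc (Suc n) \<le> a \<and> 0 \<le> b"
      using l \<open>0 \<le> a\<close>
      by - (rule exI[of _ "l1 * (b + a * (l3 ^ n * t))"], rule exI[of _ "l2 * a"],
         simp add: ab gamma_nth gamma_iterate_nth_3)
  qed
qed

lemma map_degree_gamma_iterate:
  assumes l: "0 < l1" "0 < l2" "0 < l3"
  shows "map_degree (gamma l1 l2 l3 ^^ n) = Suc n"
proof (rule antisym)
  show "map_degree (gamma l1 l2 l3 ^^ n) \<le> Suc n"
    by (rule map_degree_le[OF gamma_iterate_component_poly_fun_le])
next
  obtain K where K: "K > 0" and growth: "\<And>t. t \<ge> 0 \<Longrightarrow>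
      \<exists>a. (gamma l1 l2 l3 ^^ n) (\<chi> i. of_real t) $ 1 = of_real a \<and> K * t ^ Suc n \<le> a"
    using gamma_iterate_diagonal_growth[OF l, of n] by metis
  show "Suc n \<le> map_degree (gamma l1 l2 l3 ^^ n)"
  proof (rule map_degree_ge_of_diagonal_growth[OF polynomial_map_gamma_iterate K, where j = 1])
    fix t :: real assume "1 \<le> t"
    then obtain a where "(gamma l1 l2 l3 ^^ n) (\<chi> i. of_real t) $ 1 = of_real a"
      "K * t ^ Suc n \<le> a"
      using growth[of t] by auto
    then show "K * t ^ Suc n \<le> norm ((gamma l1 l2 l3 ^^ n) (\<chi> i. of_real t) $ 1)"
      by simp
  qed
qed

theorem theorem2:
  fixes l1 l2 l3 :: real
  assumes "0 < l1" "l1 < 1 / 2"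
    and "0 < l2" "l2 < 1 / 2"
    and "0 < l3" "l3 < 1 / 2"
  shows "poly_automorphism (gamma l1 l2 l3) \<and>
    contraction (gamma l1 l2 l3) \<and>
    linear_degree_growth (gamma l1 l2 l3)"
proof (intro conjI)
  show aut: "poly_automorphism (gamma l1 l2 l3)"
    using assms by (intro poly_automorphism_gamma) auto
  show "contraction (gamma l1 l2 l3)"
  proof (rule contraction_of_orbits_tendsto_0[OF aut])
    show "gamma l1 l2 l3 0 = 0"
      by (simp add: gamma_nth vec_eq_iff forall_3)
    show "(\<lambda>n. (gamma l1 l2 l3 ^^ n) v) \<longlonglongrightarrow> 0" for v
      using assms by (intro gamma_orbit_tendsto_0) auto
  qed
  show "linear_degree_growth (gamma l1 l2 l3)"
    unfolding linear_degree_growth_def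
    using assms by (intro exI[of _ 1] exI[of _ 2]) (auto simp: map_degree_gamma_iterate)
qed

end
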